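(* Let $n\ge 1$, let $(S_i,\mathbb{S}_i)$, $i=1,\ldots,n$, be measurable spaces, $S=\prod_{i=1}^n S_i$, $\mathbb{S}=\bigotimes_{i=1}^n\mathbb{S}_i$, let $\mathbf{X}=(X_1,\ldots,X_n)\in S$ be a random vector with distribution $P$, any probability measure on $(S,\mathbb{S})$ such that $X_1,\ldots,X_n$ are independent, and let $\mathbf{Y}$ be an independent copy of $\mathbf{X}$. (a$'$) Let $\mathcal{A},\mathcal{B}$ be finite or countable index sets, and let $\{f_\alpha\}_{\alpha\in\mathcal{A}}$ and $\{g_\beta\}_{\beta\in\mathcal{B}}$ be collections of non-negative real-valued $\mathbb{S}$-measurable functions on $S$ such that $f_\alpha$ depends on $K_\alpha\subseteq\mathbf{n}$ for each $\alpha\in\mathcal A$ and $g_\beta$ depends on $L_\beta\subseteq\mathbf{n}$ for each $\beta\in\mathcal B$. Then $$E\Big\{\sup_{\alpha\in\mathcal{A},\,\beta\in\mathcal{B}:\ K_\alpha\cap L_\beta=\emptyset} f_\alpha(\mathbf{X})g_\beta(\mathbf{Y})\Big\}\le E\Big\{\sup_{\alpha\in\mathcal{A},\,\beta\in\mathcal{B}} f_\alpha(\mathbf{X})g_\beta(\mathbf{X})\Big\}.$$ (b$'$) Let $f$ and $g$ be non-negative real-valued $\mathbb{S}$-measurable functions on $S$ and let $\mathcal{K},\mathcal{L}\subseteq 2^{\mathbf{n}}$ be any collections of subsets of $\mathbf{n}$. Then $$E\Big\{\max_{K\in\mathcal{K},\,L\in\mathcal{L}:\ K\cap L=\emptyset}\underline{f}_K(\mathbf{X})\,\underline{g}_L(\mathbf{Y})\Big\}\le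 E\{f(\mathbf{X})g(\mathbf{X})\}.$$
   Context: $\mathbf{n}=\{1,\ldots,n\}$. For $\mathbf{x}\in S$ and $K\subseteq\mathbf{n}$, $\mathbf{x}_K$ is the restriction of $\mathbf{x}$ to the coordinates in $K$, and $[\mathbf{x}]_K=\{\mathbf{y}\in S:\mathbf{y}_K=\mathbf{x}_K\}$. A function $f$ on $S$ depends on $K$ if $\mathbf{x}_K=\mathbf{y}_K$ implies $f(\mathbf{x})=f(\mathbf{y})$. The sets $K_\alpha$ (and likewise the $L_\beta$) need not be distinct. For a non-negative measurable $f$ and $K\subseteq\mathbf{n}$, $\underline{f}_K(\mathbf{x})=\operatorname{ess\,inf}_{\mathbf{y}\in[\mathbf{x}]_K}f(\mathbf{y})$, where the essential infimum is taken over the coordinates of $\mathbf{y}$ in $K^c$, with respect to the marginal $P_{K^c}$ of $P$ on those coordinates (the coordinates in $K$ being fixed equal to $\mathbf{x}_K$); $\underline{g}_L$ is defined in the same way. For $K=\mathbf{n}$, $\underline{f}_K=f$. Expectations take values in $[0,\infty]$, and the supremum (maximum) of an empty collection of non-negative quantities is $0$. *)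

theory Defs
  imports "HOL-Probability.Probability"
begin

definition depends_on :: "(nat \<Rightarrow> 'a) set \<Rightarrow> ((nat \<Rightarrow> 'a) \<Rightarrow> 'b) \<Rightarrow> nat set \<Rightarrow> bool" where
  "depends_on S f K \<longleftrightarrow>
     (\<forall>x\<in>S. \<forall>y\<in>S. restrict x K = restrict y K \<longrightarrow> f x = f y)"

definition marginal ::
  "(nat \<Rightarrow> 'a measure) \<Rightarrow> (nat \<Rightarrow> 'a) measure \<Rightarrow> nat set \<Rightarrow> (nat \<Rightarrow> 'a) measure" where
  "marginal M P J = distr P (PiM J M) (\<lambda>x. restrict x J)"

definition ess_inf :: "'b measure \<Rightarrow> ('b \<Rightarrow> ennreal) \<Rightarrow> ennreal" where
  "ess_inf N h = Sup {c. AE z in N. c \<le> h z}"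

(* The points y of the cylinder [x]_K are written as merge K (I - K) (x, z):
   x on K, and z on the remaining coordinates I - K of the index set I.
   The codomain is ennreal, and ennreal is the identity on the nonnegative
   reals, so this is the intended function only for nonnegative f. *)
definition lower_env ::
  "nat set \<Rightarrow> (nat \<Rightarrow> 'a measure) \<Rightarrow> (nat \<Rightarrow> 'a) measure \<Rightarrow> ((nat \<Rightarrow> 'a) \<Rightarrow> real) \<Rightarrow>
   nat set \<Rightarrow> (nat \<Rightarrow> 'a) \<Rightarrow> ennreal" where
  "lower_env I M P f K x =
     ess_inf (marginal M P (I - K)) (\<lambda>z. ennreal (f (merge K (I - K) (x, z))))"

end

theory Submission
  imports Defs
begin

text \<open>
  Everything rests on one combinatorial bound for the discrete cube. Points of the cube are
  subsets \<open>x\<close> of a finite set \<open>I\<close>. Let \<open>F\<close> be a set of points, each with a chosen coordinate set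
  \<open>K x\<close>, let \<open>R\<close> be the union of the subcubes through \<open>x\<close> on which the coordinates in \<open>K x\<close> are
  fixed, and \<open>Y\<close> the union of the subcubes through the antipode \<open>I - x\<close> on which the remaining
  coordinates are fixed. Reimer's theorem (\<open>reimer_antipodal\<close>) says
  \<open>card F \<le> card (R \<inter> Y)\<close>. It is proved by linear algebra: take the orthogonal bases \<open>(1,0), (0,1)\<close> and \<open>(1,1), (1,-1)\<close> of the plane, let the bit
  \<open>i \<in> x\<close> choose the basis and \<open>i \<in> K x\<close> the vector in it, the first if it holds, and let \<open>v x\<close> be the tensor product over
  \<open>i\<close>. Write \<open>e z\<close> for the product of first basis vectors at \<open>z\<close>; the \<open>e z\<close> form a basis of the
  whole space.
  Then \<open>v x\<close> lies in the span of the \<open>e z\<close> with \<open>z\<close> in the first subcube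
  (\<open>tensor_vec_in_span\<close>), and \<open>v x\<close> is orthogonal to \<open>e z\<close> unless \<open>z\<close> is in the second
  (\<open>tensor_vec_orthogonal\<close>). So a combination \<open>w\<close> of the \<open>v x\<close> that is orthogonal to \<open>e z\<close> for all
  \<open>z \<in> R \<inter> Y\<close> is orthogonal to \<open>e z\<close> for all \<open>z \<in> R\<close>, hence to itself, and vanishes. As the \<open>v x\<close>
  are linearly independent (\<open>tensor_vecs_independent\<close>), their number is at most \<open>card (R \<inter> Y)\<close>.

  Applied to the level sets of \<open>sup f\<^sub>\<alpha>\<close> and \<open>sup g\<^sub>\<beta>\<close>, and integrated over the two levels by the
  layer-cake formula, this becomes an inequality between functions on the cube that compares
  \<open>f\<^sub>\<alpha>\<close> at a point and \<open>g\<^sub>\<beta>\<close> at its antipode with both functions at the same point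
  (\<open>dual_reimer_cube\<close>).

  The passage to product measures is a symmetrisation. If \<open>x\<close> and \<open>y\<close> are independent samples of a
  product measure, exchanging \<open>x\<^sub>i\<close> and \<open>y\<^sub>i\<close> for all \<open>i\<close> in a set \<open>s\<close> does not change the joint law
  (\<open>nn_integral_mix\<close>), so one may average over \<open>s\<close>. For fixed \<open>x\<close> and \<open>y\<close> the two exchanged
  vectors range over antipodal pairs of a cube, to which the previous inequality applies; this is
  \<open>dual_reimer_PiM\<close>, and part (a') follows since a supremum over all pairs of products is a product
  of suprema. Part (b') is the case where the functions are the lower envelopes: they depend on
  the right coordinates and are almost everywhere at most the original function (\<open>AE_product_lower_env_le\<close>).
\<close>

section \<open>Reimer's theorem on the discrete cube\<close>

text \<open>
  Gaussian elimination without division. Integer rather than rational solutions are wanted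
  because linear independence of the tensor vectors below is a parity argument.
\<close>
lemma homogeneous_int_system_nontrivial:
  fixes c :: "'b \<Rightarrow> 'a \<Rightarrow> int"
  assumes "finite B" "finite A" "card B < card A"
  shows "\<exists>l. (\<exists>a\<in>A. l a \<noteq> 0) \<and> (\<forall>b\<in>B. (\<Sum>a\<in>A. l a * c b a) = 0)"
  using assms
proof (induction B arbitrary: A c rule: finite_induct)
  case empty
  then obtain a where "a \<in> A" by (metis card_gt_0_iff card.empty ex_in_conv)
  then show ?case by (intro exI[of _ "\<lambda>_. 1"]) auto
next
  case (insert b B)
  show ?case
  proof (cases "\<forall>a\<in>A. c b a = 0")
    case True
    from insert have "card B < card A" by simp
    from insert.IH[OF insert.prems(1) this, of c] True show ?thesis by auto
  next
    case False
    then obtain p where p: "p \<in> A" "c b p \<noteq> 0" by blast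
    let ?A = "A - {p}"
    have "card B < card ?A" using insert p by simp
    from insert.IH[OF _ this, of "\<lambda>b' a. c b p * c b' a - c b' p * c b a"] insert.prems
    obtain l where l: "\<exists>a\<in>?A. l a \<noteq> 0"
      "\<And>b'. b' \<in> B \<Longrightarrow> (\<Sum>a\<in>?A. l a * (c b p * c b' a - c b' p * c b a)) = 0"
      by auto
    define m where "m = (\<lambda>a. if a = p then - (\<Sum>a\<in>?A. l a * c b a) else c b p * l a)"
    have m: "(\<Sum>a\<in>A. m a * c b' a)
        = - (\<Sum>a\<in>?A. l a * c b a) * c b' p + c b p * (\<Sum>a\<in>?A. l a * c b' a)" for b'
    proof -
      have "(\<Sum>a\<in>A. m a * c b' a) = m p * c b' p + (\<Sum>a\<in>?A. m a * c b' a)"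
        using p insert.prems by (simp add: sum.remove)
      also have "(\<Sum>a\<in>?A. m a * c b' a) = (\<Sum>a\<in>?A. c b p * (l a * c b' a))"
        by (intro sum.cong) (auto simp: m_def)
      finally show ?thesis by (simp add: m_def sum_distrib_left)
    qed
    have "\<exists>a\<in>A. m a \<noteq> 0" using l(1) p by (auto simp: m_def)
    moreover have "(\<Sum>a\<in>A. m a * c b' a) = 0" if "b' \<in> insert b B" for b'
    proof (cases "b' = b")
      case False
      with that have "(\<Sum>a\<in>?A. l a * (c b p * c b' a - c b' p * c b a)) = 0" using l by auto
      then have "c b p * (\<Sum>a\<in>?A. l a * c b' a) - c b' p * (\<Sum>a\<in>?A. l a * c b a) = 0"
        by (simp add: algebra_simps sum_subtractf sum_distrib_left)
      then show ?thesis by (simp add: m algebra_simps)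
    qed (simp add: m)
    ultimately show ?thesis by blast
  qed
qed

text \<open>
  Coordinates of one tensor factor. The first bit selects one of the orthogonal bases
  \<open>(1,0), (0,1)\<close> and \<open>(1,1), (1,-1)\<close>, the second bit selects the first or second vector of that
  basis, and the third is the index of the coordinate.
\<close>
fun coord_factor :: "bool \<Rightarrow> bool \<Rightarrow> bool \<Rightarrow> int" where
  "coord_factor False True u = (if u then 0 else 1)"
| "coord_factor False False u = (if u then 1 else 0)"
| "coord_factor True True u = 1"
| "coord_factor True False u = (if u then -1 else 1)"

lemma coord_factor_sums:
  "coord_factor False k False + coord_factor False k True = 1"
  "even (a * coord_factor True k False * b + a * coord_factor True k True * b)"
  "coord_factor True k False = 1"
  by (cases k; simp)+

definition tensor_vec :: "'i set \<Rightarrow> 'i set \<Rightarrow> 'i set \<Rightarrow> 'i set \<Rightarrow> int" where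
  "tensor_vec I K x u = (\<Prod>i\<in>I. coord_factor (i \<in> x) (i \<in> K) (i \<in> u))"

lemma tensor_vec_insert:
  assumes "finite I" "j \<notin> I"
  shows "tensor_vec (insert j I) K x u = coord_factor (j \<in> x) (j \<in> K) (j \<in> u) * tensor_vec I K x u"
  using assms by (simp add: tensor_vec_def)

lemma tensor_vec_insert_irrelevant:
  assumes "j \<notin> I"
  shows "tensor_vec I K (insert j x) u = tensor_vec I K x u"
    "tensor_vec I K x (insert j u) = tensor_vec I K x u"
proof -
  have "i \<noteq> j" if "i \<in> I" for i using that assms by auto
  then show "tensor_vec I K (insert j x) u = tensor_vec I K x u"
    "tensor_vec I K x (insert j u) = tensor_vec I K x u"
    by (auto simp: tensor_vec_def intro!: prod.cong)
qed

lemma sum_Pow_insert: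
  fixes h :: "'i set \<Rightarrow> 'c::comm_monoid_add"
  assumes "finite I" "j \<notin> I"
  shows "(\<Sum>x\<in>Pow (insert j I). h x) = (\<Sum>x\<in>Pow I. h x) + (\<Sum>x\<in>Pow I. h (insert j x))"
proof -
  have "inj_on (insert j) (Pow I)" using assms by (auto simp: inj_on_def)
  moreover have "Pow I \<inter> insert j ` Pow I = {}" using assms by auto
  ultimately show ?thesis
    unfolding Pow_insert using assms
    by (subst sum.union_disjoint) (auto simp: sum.reindex)
qed

text \<open>
  Modulo 2 both vectors of the second basis are \<open>(1,1)\<close>. So at a coordinate \<open>j\<close>, adding the two halves
  of a combination that vanishes modulo 2 kills all terms with \<open>j \<in> x\<close>, while each term with \<open>j \<notin> x\<close> survives in
  exactly one half, whichever of \<open>(1,0)\<close> and \<open>(0,1)\<close> was selected. The induction hypothesis then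
  disposes of the terms with \<open>j \<notin> x\<close>, after which one half alone gives those with \<open>j \<in> x\<close>.
\<close>
lemma tensor_vecs_independent_mod2:
  assumes "finite I"
    and "\<And>u. u \<subseteq> I \<Longrightarrow> even (\<Sum>x\<in>Pow I. c x * tensor_vec I (K x) x u)"
    and "x \<subseteq> I"
  shows "even (c x)"
  using assms
proof (induction I arbitrary: c K x rule: finite_induct)
  case empty
  then show ?case by (auto simp: tensor_vec_def)
next
  case (insert j I)
  \<comment> \<open>The halves of the combination at \<open>j\<close>: \<open>S\<close> collects the terms with \<open>j \<notin> x\<close> and \<open>T\<close> those with \<open>j \<in> x\<close>.\<close>
  define S where "S b u = (\<Sum>x\<in>Pow I. c x * coord_factor False (j \<in> K x) b * tensor_vec I (K x) x u)" for b u
  define T where "T b u = (\<Sum>x\<in>Pow I. c (insert j x) * coord_factor True (j \<in> K (insert j x)) b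
      * tensor_vec I (K (insert j x)) x u)" for b u
  have eq: "(\<Sum>x\<in>Pow (insert j I). c x * tensor_vec (insert j I) (K x) x u) = S (j \<in> u) u + T (j \<in> u) u" for u
  proof -
    have "j \<notin> x" if "x \<in> Pow I" for x using that insert.hyps by auto
    then show ?thesis
      unfolding sum_Pow_insert[OF insert.hyps] S_def T_def
      by (intro arg_cong2[where f="(+)"] sum.cong)
         (use insert.hyps in \<open>simp_all add: tensor_vec_insert tensor_vec_insert_irrelevant\<close>)
  qed
  have SF: "even (S False u + T False u)" if "u \<subseteq> I" for u
  proof -
    have "j \<notin> u" using that insert.hyps by auto
    then show ?thesis using insert.prems(1)[of u] that by (auto simp: eq)
  qed
  have ST: "even (S True u + T True u)" if "u \<subseteq> I" for u
  proof -
    have "even (S True (insert j u) + T True (insert j u))"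
      using insert.prems(1)[of "insert j u"] that eq[of "insert j u"] by (auto simp: subset_insertI2)
    then show ?thesis using insert.hyps by (simp add: S_def T_def tensor_vec_insert_irrelevant)
  qed
  have c0: "even (c x)" if "x \<subseteq> I" for x
  proof (rule insert.IH[of c K, OF _ that])
    fix u assume u: "u \<subseteq> I"
    have "S False u + S True u = (\<Sum>x\<in>Pow I. c x * tensor_vec I (K x) x u)"
      unfolding S_def sum.distrib[symmetric]
      by (simp add: coord_factor_sums distrib_left[symmetric] distrib_right[symmetric])
    moreover have "even (T False u + T True u)"
      unfolding T_def sum.distrib[symmetric]
      by (intro dvd_sum coord_factor_sums)
    ultimately show "even (\<Sum>x\<in>Pow I. c x * tensor_vec I (K x) x u)"
      using SF[OF u] ST[OF u] by presburger
  qed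
  have c1: "even (c (insert j x))" if "x \<subseteq> I" for x
  proof (rule insert.IH[of "\<lambda>x. c (insert j x)" "\<lambda>x. K (insert j x)", OF _ that])
    fix u assume u: "u \<subseteq> I"
    have "even (S False u)" unfolding S_def by (intro dvd_sum) (auto simp: c0)
    then have "even (T False u)" using SF[OF u] by auto
    also have "T False u = (\<Sum>x\<in>Pow I. c (insert j x) * tensor_vec I (K (insert j x)) x u)"
      by (simp add: T_def coord_factor_sums)
    finally show "even (\<Sum>x\<in>Pow I. c (insert j x) * tensor_vec I (K (insert j x)) x u)" .
  qed
  show ?case
  proof (cases "j \<in> x")
    case True
    then show ?thesis using c1[of "x - {j}"] insert.prems(2) by (auto simp: insert_absorb)
  next
    case False
    then show ?thesis using c0[of x] insert.prems(2) by auto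
  qed
qed

text \<open>
  Infinite descent: the coefficients of a vanishing combination are even, and halving them gives
  another vanishing combination.
\<close>
lemma tensor_vecs_independent:
  assumes "finite I"
    and "\<And>u. u \<subseteq> I \<Longrightarrow> (\<Sum>x\<in>Pow I. c x * tensor_vec I (K x) x u) = 0"
    and x: "x \<subseteq> I"
  shows "c x = 0"
proof -
  have "\<forall>x\<in>Pow I. 2 ^ k dvd c x" for k :: nat
  proof (induction k)
    case (Suc k)
    then obtain d where d: "\<And>x. x \<in> Pow I \<Longrightarrow> c x = 2 ^ k * d x" unfolding dvd_def by metis
    have "even (d x)" if "x \<subseteq> I" for x
    proof (rule tensor_vecs_independent_mod2[OF assms(1) _ that, of d K])
      fix u assume u: "u \<subseteq> I"
      have "0 = 2 ^ k * (\<Sum>x\<in>Pow I. d x * tensor_vec I (K x) x u)"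
        using assms(2)[OF u] by (simp add: d sum_distrib_left mult.assoc)
      then show "even (\<Sum>x\<in>Pow I. d x * tensor_vec I (K x) x u)" by simp
    qed
    then show ?case by (auto simp: d mult_dvd_mono)
  qed simp
  then have "2 ^ nat \<bar>c x\<bar> dvd c x" using x by auto
  moreover have "\<bar>c x\<bar> < 2 ^ nat \<bar>c x\<bar>"
  proof -
    have "int (nat \<bar>c x\<bar>) < int (2 ^ nat \<bar>c x\<bar>)" by (subst of_nat_less_iff) (rule less_exp)
    then show ?thesis by simp
  qed
  ultimately show ?thesis using zdvd_not_zless[of "\<bar>c x\<bar>" "2 ^ nat \<bar>c x\<bar>"] by fastforce
qed

text \<open>
  At a coordinate outside \<open>K\<close> where \<open>z\<close> and \<open>x\<close> agree, the factors of the two vectors are the first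
  and the second member of the same orthogonal basis.
\<close>
lemma tensor_vec_orthogonal:
  assumes "finite I" "i \<in> I - K" "i \<in> z \<longleftrightarrow> i \<in> x"
  shows "(\<Sum>u\<in>Pow I. tensor_vec I I z u * tensor_vec I K x u) = 0"
proof -
  define h where "h b i = coord_factor (i \<in> z) True b * coord_factor (i \<in> x) (i \<in> K) b" for b i
  have "(\<Sum>u\<in>Pow I. tensor_vec I I z u * tensor_vec I K x u)
      = (\<Sum>u\<in>Pow I. (\<Prod>i\<in>u. h True i) * (\<Prod>i\<in>I - u. h False i))"
  proof (rule sum.cong[OF refl])
    fix u assume u: "u \<in> Pow I"
    have "tensor_vec I I z u * tensor_vec I K x u = (\<Prod>i\<in>I. h (i \<in> u) i)"
      unfolding tensor_vec_def prod.distrib[symmetric] h_def by (rule prod.cong) auto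
    also have "\<dots> = (\<Prod>i\<in>I - u. h (i \<in> u) i) * (\<Prod>i\<in>u. h (i \<in> u) i)"
      using u assms(1) by (intro prod.subset_diff) auto
    also have "\<dots> = (\<Prod>i\<in>u. h True i) * (\<Prod>i\<in>I - u. h False i)"
      by (simp add: mult.commute)
    finally show "tensor_vec I I z u * tensor_vec I K x u
      = (\<Prod>i\<in>u. h True i) * (\<Prod>i\<in>I - u. h False i)" .
  qed
  also have "\<dots> = (\<Prod>i\<in>I. h True i + h False i)"
    by (rule prod_add[symmetric]) fact
  also have "\<dots> = 0"
  proof (rule prod_zero[OF assms(1)])
    have "h True i + h False i = 0"
      using assms by (cases "i \<in> x") (auto simp: h_def)
    then show "\<exists>i\<in>I. h True i + h False i = 0" using assms by auto
  qed
  finally show ?thesis .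
qed

text \<open>
  A coordinate in \<open>K\<close> already carries a first basis vector. At the others the second basis
  vectors are expanded by \<open>(0,1) = (1,1) - (1,0)\<close> and \<open>(1,-1) = 2 (1,0) - (1,1)\<close>, which lets \<open>z\<close> vary
  freely there.
\<close>
lemma tensor_vec_in_span:
  assumes "finite I"
  obtains a where "\<forall>z\<in>Pow I. a z \<noteq> 0 \<longrightarrow> z \<inter> K \<inter> I = x \<inter> K \<inter> I"
    and "\<forall>u. tensor_vec I K x u = (\<Sum>z\<in>Pow I. a z * tensor_vec I I z u)"
proof -
  \<comment> \<open>The coefficients of \<open>(1,1)\<close> and of \<open>(1,0)\<close> in the factor at \<open>i\<close>.\<close>
  define p where "p i = (if i \<in> K then if i \<in> x then 1 else 0 else if i \<in> x then -1 else 1::int)" for i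
  define q where "q i = (if i \<in> K then if i \<in> x then 0 else 1 else if i \<in> x then 2 else -1::int)" for i
  define a where "a z = (\<Prod>i\<in>z. p i) * (\<Prod>i\<in>I - z. q i)" for z
  have "z \<inter> K \<inter> I = x \<inter> K \<inter> I" if "z \<in> Pow I" "a z \<noteq> 0" for z
  proof -
    have "finite z" using that assms finite_subset by auto
    then have "\<forall>i\<in>z. p i \<noteq> 0" "\<forall>i\<in>I - z. q i \<noteq> 0"
      using that assms by (auto simp: a_def)
    then show ?thesis using that unfolding p_def q_def
      by (auto split: if_splits)
  qed
  moreover have "tensor_vec I K x u = (\<Sum>z\<in>Pow I. a z * tensor_vec I I z u)" for u
  proof -
    have "coord_factor (i \<in> x) (i \<in> K) b = p i * coord_factor True True b + q i * coord_factor False True b" for i b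
      by (cases "i \<in> x"; cases "i \<in> K"; cases b) (auto simp: p_def q_def)
    then have "tensor_vec I K x u
        = (\<Prod>i\<in>I. p i * coord_factor True True (i \<in> u) + q i * coord_factor False True (i \<in> u))"
      by (simp add: tensor_vec_def)
    also have "\<dots> = (\<Sum>z\<in>Pow I. (\<Prod>i\<in>z. p i * coord_factor True True (i \<in> u))
        * (\<Prod>i\<in>I - z. q i * coord_factor False True (i \<in> u)))"
      by (rule prod_add) fact
    also have "\<dots> = (\<Sum>z\<in>Pow I. a z * tensor_vec I I z u)"
    proof (rule sum.cong[OF refl])
      fix z assume z: "z \<in> Pow I"
      have "tensor_vec I I z u = (\<Prod>i\<in>I - z. coord_factor (i \<in> z) (i \<in> I) (i \<in> u))
          * (\<Prod>i\<in>z. coord_factor (i \<in> z) (i \<in> I) (i \<in> u))"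
        unfolding tensor_vec_def using z assms by (intro prod.subset_diff) auto
      also have "(\<Prod>i\<in>z. coord_factor (i \<in> z) (i \<in> I) (i \<in> u)) = (\<Prod>i\<in>z. coord_factor True True (i \<in> u))"
        using z by (intro prod.cong refl) (auto simp: subset_iff)
      also have "(\<Prod>i\<in>I - z. coord_factor (i \<in> z) (i \<in> I) (i \<in> u)) = (\<Prod>i\<in>I - z. coord_factor False True (i \<in> u))"
        by (intro prod.cong) auto
      finally show "(\<Prod>i\<in>z. p i * coord_factor True True (i \<in> u)) * (\<Prod>i\<in>I - z. q i * coord_factor False True (i \<in> u))
          = a z * tensor_vec I I z u"
        by (simp add: a_def prod.distrib)
    qed
    finally show ?thesis .
  qed
  ultimately show ?thesis by (intro that[of a]) simp_all
qed

text \<open>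
  Reimer's theorem, with \<open>K\<close> depending on \<open>x\<close>. If there were more points \<open>x\<close> than elements of
  \<open>A \<inter> B\<close>, some nontrivial combination \<open>w\<close> of the vectors of these points would be orthogonal to
  \<open>e z\<close> for every \<open>z \<in> A \<inter> B\<close>. For \<open>z \<in> A - B\<close> this orthogonality is automatic, so \<open>w\<close> is orthogonal to
  the span of the \<open>e z\<close> with \<open>z \<in> A\<close>. As that span contains \<open>w\<close>, it follows that \<open>w = 0\<close>,
  against linear independence.
\<close>
lemma reimer_antipodal:
  fixes I :: "'i set" and A B :: "'i set set"
  assumes fin: "finite I"
  shows "card {x \<in> Pow I. \<exists>K. (\<forall>z\<in>Pow I. z \<inter> K = x \<inter> K \<longrightarrow> z \<in> A) \<and>
            (\<forall>z\<in>Pow I. z - K = (I - x) - K \<longrightarrow> z \<in> B)} \<le> card (Pow I \<inter> A \<inter> B)"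
    (is "card ?F \<le> card ?Z")
proof (rule ccontr)
  define Q where "Q x K \<longleftrightarrow> (\<forall>z\<in>Pow I. z \<inter> K = x \<inter> K \<longrightarrow> z \<in> A) \<and>
    (\<forall>z\<in>Pow I. z - K = (I - x) - K \<longrightarrow> z \<in> B)" for x K
  define F where "F = {x \<in> Pow I. \<exists>K. Q x K}"
  define Z where "Z = Pow I \<inter> A \<inter> B"
  assume "\<not> ?thesis"
  then have less: "card Z < card F" by (simp add: Z_def F_def Q_def)
  have finZ: "finite Z" and finF: "finite F" using fin by (auto simp: Z_def F_def)
  define K where "K x = (SOME K. Q x K)" for x
  have "Q x (K x)" if "x \<in> F" for x
    using that unfolding F_def K_def by (auto intro: someI)
  then have K: "\<And>x z. x \<in> F \<Longrightarrow> z \<in> Pow I \<Longrightarrow> z \<inter> K x = x \<inter> K x \<Longrightarrow> z \<in> A"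
      "\<And>x z. x \<in> F \<Longrightarrow> z \<in> Pow I \<Longrightarrow> z - K x = (I - x) - K x \<Longrightarrow> z \<in> B"
    unfolding Q_def by blast+
  have FI: "x \<subseteq> I" if "x \<in> F" for x using that by (simp add: F_def)
  define v where "v x = tensor_vec I (K x) x" for x
  define e where "e z = tensor_vec I I z" for z
  define ip where "ip f g = (\<Sum>u\<in>Pow I. f u * g u)" for f g :: "'i set \<Rightarrow> int"
  obtain l where l: "\<exists>x\<in>F. l x \<noteq> 0" "\<And>z. z \<in> Z \<Longrightarrow> (\<Sum>x\<in>F. l x * ip (e z) (v x)) = 0"
    using homogeneous_int_system_nontrivial[OF finZ finF less, of "\<lambda>z x. ip (e z) (v x)"] by blast
  define w where "w u = (\<Sum>x\<in>F. l x * v x u)" for u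
  have ipw: "ip f w = (\<Sum>x\<in>F. l x * ip f (v x))" for f
    unfolding ip_def w_def sum_distrib_left by (subst sum.swap) (simp add: mult_ac)
  have e_w: "ip (e z) w = 0" if z: "z \<in> Pow I" "z \<in> A" for z
  proof (cases "z \<in> B")
    case True
    then show ?thesis using l(2) z by (simp add: ipw Z_def)
  next
    case False
    have "ip (e z) (v x) = 0" if x: "x \<in> F" for x
    proof -
      have "z - K x \<noteq> (I - x) - K x" using K(2)[OF x z(1)] False by auto
      then obtain i where "i \<in> I - K x" "i \<in> z \<longleftrightarrow> i \<in> x" using z by auto
      then show ?thesis unfolding ip_def e_def v_def by (rule tensor_vec_orthogonal[OF fin])
    qed
    then show ?thesis by (simp add: ipw)
  qed
  have v_w: "ip (v x) w = 0" if x: "x \<in> F" for x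
  proof -
    obtain a where a: "\<forall>z\<in>Pow I. a z \<noteq> 0 \<longrightarrow> z \<inter> K x \<inter> I = x \<inter> K x \<inter> I"
      and "\<forall>u. tensor_vec I (K x) x u = (\<Sum>z\<in>Pow I. a z * tensor_vec I I z u)"
      by (rule tensor_vec_in_span[OF fin, where K="K x" and x=x])
    then have v_eq: "\<forall>u. v x u = (\<Sum>z\<in>Pow I. a z * e z u)" by (simp add: v_def e_def)
    have "ip (v x) w = (\<Sum>u\<in>Pow I. \<Sum>z\<in>Pow I. a z * (e z u * w u))"
      unfolding ip_def using v_eq by (simp add: sum_distrib_right mult.assoc)
    also have "\<dots> = (\<Sum>z\<in>Pow I. a z * ip (e z) w)"
      unfolding ip_def by (subst sum.swap) (simp add: sum_distrib_left)
    also have "\<dots> = 0"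
    proof (rule sum.neutral, rule ballI)
      fix z assume z: "z \<in> Pow I"
      show "a z * ip (e z) w = 0"
      proof (cases "a z = 0")
        case False
        with a FI[OF x] z have "z \<inter> K x = x \<inter> K x" by auto
        then show ?thesis using e_w[OF z] K(1)[OF x z] by auto
      qed simp
    qed
    finally show ?thesis .
  qed
  have "ip w w = (\<Sum>x\<in>F. l x * ip (v x) w)"
    unfolding ipw[of w] by (simp add: ip_def mult.commute)
  then have "ip w w = 0" using v_w by simp
  then have w0: "w u = 0" if "u \<in> Pow I" for u
    using that sum_nonneg_eq_0_iff[of "Pow I" "\<lambda>u. w u * w u"] fin unfolding ip_def by simp
  define c where "c x = (if x \<in> F then l x else 0)" for x
  have c0: "c x = 0" if "x \<subseteq> I" for x
  proof (rule tensor_vecs_independent[OF fin _ that, of c K])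
    fix u assume u: "u \<subseteq> I"
    have "(\<Sum>x\<in>Pow I. c x * v x u) = (\<Sum>x\<in>F. c x * v x u)"
      using fin FI by (intro sum.mono_neutral_right) (auto simp: c_def)
    also have "\<dots> = w u" unfolding w_def by (intro sum.cong) (auto simp: c_def)
    finally show "(\<Sum>x\<in>Pow I. c x * tensor_vec I (K x) x u) = 0"
      using w0 u by (simp add: v_def)
  qed
  obtain x where "x \<in> F" "l x \<noteq> 0" using l(1) by blast
  then show False using c0[of x] FI[of x] by (simp add: c_def)
qed

section \<open>From sets to functions\<close>

lemma SUP_Times_mult_ennreal:
  fixes u :: "'a \<Rightarrow> ennreal" and v :: "'b \<Rightarrow> ennreal"
  shows "(SUP (a, b)\<in>A \<times> B. u a * v b) = (SUP a\<in>A. u a) * (SUP b\<in>B. v b)"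
proof (rule antisym)
  show "(SUP (a, b)\<in>A \<times> B. u a * v b) \<le> (SUP a\<in>A. u a) * (SUP b\<in>B. v b)"
    by (auto intro!: SUP_least mult_mono SUP_upper)
  have "(SUP a\<in>A. u a) * (SUP b\<in>B. v b) = (SUP a\<in>A. SUP b\<in>B. u a * v b)"
    by (subst SUP_mult_right_ennreal) (simp add: SUP_mult_left_ennreal)
  also have "\<dots> \<le> (SUP (a, b)\<in>A \<times> B. u a * v b)"
    by (intro SUP_least SUP_upper2[of "(_, _)"]) auto
  finally show "(SUP a\<in>A. u a) * (SUP b\<in>B. v b) \<le> (SUP (a, b)\<in>A \<times> B. u a * v b)" .
qed

definition below :: "ennreal \<Rightarrow> real set" where
  "below a = {r. 0 \<le> r \<and> ennreal r < a}"

lemma below_sets [measurable]: "below a \<in> sets borel"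
  unfolding below_def by measurable

lemma below_mono: "a \<le> b \<Longrightarrow> below a \<subseteq> below b"
  by (auto simp: below_def)

lemma emeasure_below: "emeasure lborel (below a) = a"
proof (cases a)
  case (real c)
  then have "below a = {0..<c}" by (auto simp: below_def ennreal_less_iff)
  then show ?thesis using real by simp
next
  case top
  then have "below a = {0..}" by (auto simp: below_def)
  moreover have "(SUP k. of_nat k) \<le> emeasure lborel {0::real..}"
  proof (rule SUP_least)
    fix k :: nat
    have "emeasure lborel {0..real k} \<le> emeasure lborel {0::real..}"
      by (intro emeasure_mono) auto
    then show "of_nat k \<le> emeasure lborel {0::real..}"
      by (simp add: ennreal_of_nat_eq_real_of_nat)
  qed
  then have "emeasure lborel {0::real..} = top"
    by (simp add: ennreal_SUP_of_nat_eq_top top_unique)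
  ultimately show ?thesis using top by simp
qed

lemma emeasure_below_Times:
  "emeasure (lborel \<Otimes>\<^sub>M lborel) (below a \<times> below b) = a * b"
  by (subst lborel.emeasure_pair_measure_Times) (simp_all add: emeasure_below)

text \<open>
  By \<open>emeasure_below_Times\<close> a product \<open>a * b\<close> is the area of the rectangle \<open>below a \<times> below b\<close>. On the
  left the supremum is at most the area of a union \<open>U x\<close> of rectangles; on the right the
  product is the area of one rectangle \<open>V x\<close>. Both sums over \<open>x\<close> are integrals of the number of regions
  that contain a given point \<open>(r, t)\<close>, and those numbers are compared by Reimer's theorem for the
  level sets \<open>sup f > r\<close> and \<open>sup g > t\<close>: if \<open>f a x > r\<close>, then \<open>sup f > r\<close> on the whole subcube with the
  coordinates in \<open>K a\<close> fixed, and likewise for \<open>g b\<close> at the antipode, as \<open>L b\<close> avoids \<open>K a\<close>.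
\<close>
lemma dual_reimer_cube:
  fixes I :: "'i set" and A :: "'a set" and B :: "'b set"
    and f :: "'a \<Rightarrow> 'i set \<Rightarrow> ennreal" and g :: "'b \<Rightarrow> 'i set \<Rightarrow> ennreal"
  assumes fin: "finite I" and cnt: "countable A" "countable B"
    and f: "\<And>a x y. a \<in> A \<Longrightarrow> x \<subseteq> I \<Longrightarrow> y \<subseteq> I \<Longrightarrow> x \<inter> K a = y \<inter> K a \<Longrightarrow> f a x = f a y"
    and g: "\<And>b x y. b \<in> B \<Longrightarrow> x \<subseteq> I \<Longrightarrow> y \<subseteq> I \<Longrightarrow> x \<inter> L b = y \<inter> L b \<Longrightarrow> g b x = g b y"
  shows "(\<Sum>x\<in>Pow I. SUP (a, b)\<in>{(a, b). a \<in> A \<and> b \<in> B \<and> K a \<inter> L b = {}}. f a x * g b (I - x))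
    \<le> (\<Sum>x\<in>Pow I. (SUP a\<in>A. f a x) * (SUP b\<in>B. g b x))"
proof -
  define D where "D = {(a, b). a \<in> A \<and> b \<in> B \<and> K a \<inter> L b = {}}"
  define \<mu> where "\<mu> = (lborel \<Otimes>\<^sub>M lborel :: (real \<times> real) measure)"
  define F where "F x = (SUP a\<in>A. f a x)" for x
  define G where "G x = (SUP b\<in>B. g b x)" for x
  define U where "U x = (\<Union>(a, b)\<in>D. below (f a x) \<times> below (g b (I - x)))" for x
  define V where "V x = below (F x) \<times> below (G x)" for x
  have "countable D" by (rule countable_subset[of _ "A \<times> B"]) (use cnt in \<open>auto simp: D_def\<close>)
  then have U[measurable]: "U x \<in> sets \<mu>" for x
    unfolding U_def \<mu>_def by (intro sets.countable_UN') (auto intro!: pair_measureI)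
  have V[measurable]: "V x \<in> sets \<mu>" for x
    unfolding V_def \<mu>_def by (auto intro!: pair_measureI)
  have count: "card {x \<in> Pow I. p \<in> U x} \<le> card {x \<in> Pow I. p \<in> V x}" for p
  proof -
    define A' where "A' = {x. fst p \<in> below (F x)}"
    define B' where "B' = {x. snd p \<in> below (G x)}"
    have "{x \<in> Pow I. p \<in> U x} \<subseteq> {x \<in> Pow I. \<exists>K. (\<forall>z\<in>Pow I. z \<inter> K = x \<inter> K \<longrightarrow> z \<in> A') \<and>
            (\<forall>z\<in>Pow I. z - K = (I - x) - K \<longrightarrow> z \<in> B')}"
    proof safe
      fix x assume x: "x \<subseteq> I" "p \<in> U x"
      then obtain a b where ab: "a \<in> A" "b \<in> B" "K a \<inter> L b = {}"
        and p: "fst p \<in> below (f a x)" "snd p \<in> below (g b (I - x))"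
        by (auto simp: U_def D_def)
      have 1: "z \<in> A'" if z: "z \<subseteq> I" "z \<inter> K a = x \<inter> K a" for z
      proof -
        have "f a z \<le> F z" unfolding F_def using ab(1) by (rule SUP_upper)
        then have "f a x \<le> F z" using f[OF ab(1) z(1) x(1) z(2)] by simp
        then show ?thesis using below_mono p(1) unfolding A'_def by blast
      qed
      have 2: "z \<in> B'" if z: "z \<subseteq> I" "z - K a = (I - x) - K a" for z
      proof -
        have "z \<inter> L b = (I - x) \<inter> L b" using z(2) ab(3) by blast
        then have "g b z = g b (I - x)" using z(1) by (intro g[OF ab(2)]) auto
        moreover have "g b z \<le> G z" unfolding G_def using ab(2) by (rule SUP_upper)
        ultimately have "g b (I - x) \<le> G z" by simp
        then show ?thesis using below_mono p(2) unfolding B'_def by blast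
      qed
      show "\<exists>K. (\<forall>z\<in>Pow I. z \<inter> K = x \<inter> K \<longrightarrow> z \<in> A') \<and>
          (\<forall>z\<in>Pow I. z - K = I - x - K \<longrightarrow> z \<in> B')"
        using 1 2 by (intro exI[of _ "K a"]) auto
    qed
    then have "card {x \<in> Pow I. p \<in> U x} \<le> card {x \<in> Pow I. \<exists>K. (\<forall>z\<in>Pow I. z \<inter> K = x \<inter> K \<longrightarrow> z \<in> A') \<and>
            (\<forall>z\<in>Pow I. z - K = (I - x) - K \<longrightarrow> z \<in> B')}"
      using fin by (intro card_mono) auto
    also have "\<dots> \<le> card (Pow I \<inter> A' \<inter> B')" by (rule reimer_antipodal[OF fin])
    also have "Pow I \<inter> A' \<inter> B' = {x \<in> Pow I. p \<in> V x}"
      by (cases p) (auto simp: A'_def B'_def V_def)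
    finally show ?thesis .
  qed
  have int: "(\<Sum>x\<in>Pow I. emeasure \<mu> (W x)) = (\<integral>\<^sup>+p. of_nat (card {x \<in> Pow I. p \<in> W x}) \<partial>\<mu>)"
    if [measurable]: "\<And>x. W x \<in> sets \<mu>" for W
  proof -
    have "(\<Sum>x\<in>Pow I. emeasure \<mu> (W x)) = (\<Sum>x\<in>Pow I. \<integral>\<^sup>+p. indicator (W x) p \<partial>\<mu>)"
      by simp
    also have "\<dots> = (\<integral>\<^sup>+p. (\<Sum>x\<in>Pow I. indicator (W x) p) \<partial>\<mu>)"
      by (subst nn_integral_sum) auto
    also have "(\<lambda>p. \<Sum>x\<in>Pow I. indicator (W x) p) = (\<lambda>p. of_nat (card {x \<in> Pow I. p \<in> W x}) :: ennreal)"
      using fin by (auto simp: indicator_def sum.If_cases Int_def fun_eq_iff)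
    finally show ?thesis .
  qed
  have "(\<Sum>x\<in>Pow I. SUP (a, b)\<in>D. f a x * g b (I - x)) \<le> (\<Sum>x\<in>Pow I. emeasure \<mu> (U x))"
  proof (intro sum_mono SUP_least, clarify)
    fix x a b assume "(a, b) \<in> D"
    then have "below (f a x) \<times> below (g b (I - x)) \<subseteq> U x" unfolding U_def by auto
    then have "emeasure \<mu> (below (f a x) \<times> below (g b (I - x))) \<le> emeasure \<mu> (U x)"
      by (intro emeasure_mono) auto
    then show "f a x * g b (I - x) \<le> emeasure \<mu> (U x)"
      by (simp add: \<mu>_def emeasure_below_Times)
  qed
  also have "\<dots> \<le> (\<Sum>x\<in>Pow I. emeasure \<mu> (V x))"
    using count by (simp add: int nn_integral_mono)
  also have "\<dots> = (\<Sum>x\<in>Pow I. F x * G x)"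
    by (simp add: V_def \<mu>_def emeasure_below_Times)
  finally show ?thesis by (simp add: D_def F_def G_def)
qed

section \<open>Symmetrisation of product measures\<close>

definition mix :: "'i set \<Rightarrow> 'i set \<Rightarrow> ('i \<Rightarrow> 'a) \<Rightarrow> ('i \<Rightarrow> 'a) \<Rightarrow> 'i \<Rightarrow> 'a" where
  "mix I s x y = (\<lambda>i\<in>I. if i \<in> s then y i else x i)"

lemma measurable_mix [measurable]:
  assumes "f \<in> N \<rightarrow>\<^sub>M PiM I M" "g \<in> N \<rightarrow>\<^sub>M PiM I M"
  shows "(\<lambda>\<omega>. mix I s (f \<omega>) (g \<omega>)) \<in> N \<rightarrow>\<^sub>M PiM I M"
  unfolding mix_def
proof (rule measurable_restrict)
  fix i assume "i \<in> I"
  then have "(\<lambda>\<omega>. f \<omega> i) \<in> N \<rightarrow>\<^sub>M M i" "(\<lambda>\<omega>. g \<omega> i) \<in> N \<rightarrow>\<^sub>M M i"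
    using assms by (auto intro: measurable_compose[OF _ measurable_component_singleton])
  then show "(\<lambda>\<omega>. if i \<in> s then g \<omega> i else f \<omega> i) \<in> N \<rightarrow>\<^sub>M M i" by simp
qed

text \<open>
  A pair of independent samples is one sample of the product measure over the doubled index set
  \<open>J = I \<times> bool\<close>. There an exchange of coordinates is a relabelling of indices, and the law of the
  relabelled sample can be read off boxes.
\<close>
lemma nn_integral_mix:
  fixes M :: "'i \<Rightarrow> 'a measure" and I :: "'i set"
    and H :: "('i \<Rightarrow> 'a) \<times> ('i \<Rightarrow> 'a) \<Rightarrow> ennreal"
  assumes "product_prob_space M" and fin: "finite I"
    and H[measurable]: "H \<in> borel_measurable (PiM I M \<Otimes>\<^sub>M PiM I M)"
  shows "(\<integral>\<^sup>+\<omega>. H (mix I s (fst \<omega>) (snd \<omega>), mix I s (snd \<omega>) (fst \<omega>)) \<partial>(PiM I M \<Otimes>\<^sub>M PiM I M))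
    = (\<integral>\<^sup>+\<omega>. H \<omega> \<partial>(PiM I M \<Otimes>\<^sub>M PiM I M))"
proof -
  interpret product_prob_space M I by fact
  interpret P: prob_space "PiM I M" by (rule prob_space_PiM) (rule M.prob_space_axioms)
  define J where "J = I \<times> (UNIV :: bool set)"
  define N where "N j = M (fst j)" for j :: "'i \<times> bool"
  interpret N: product_prob_space N J
    by (simp add: product_prob_space_def product_prob_space_axioms_def product_sigma_finite_def
        N_def M.prob_space_axioms M.sigma_finite_measure_axioms)
  \<comment> \<open>\<open>\<phi> s\<close> merges two samples after exchanging the coordinates in \<open>s\<close>, and \<open>\<pi>\<close> takes the merged sample apart.\<close>
  define \<phi> where "\<phi> s \<omega> = (\<lambda>j\<in>J. (if snd j \<noteq> (fst j \<in> s) then snd \<omega> else fst \<omega>) (fst j))"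
    for s :: "'i set" and \<omega> :: "('i \<Rightarrow> 'a) \<times> ('i \<Rightarrow> 'a)"
  define \<pi> where "\<pi> z = ((\<lambda>i\<in>I. z (i, False)), (\<lambda>i\<in>I. z (i, True)))" for z :: "'i \<times> bool \<Rightarrow> 'a"
  let ?PP = "PiM I M \<Otimes>\<^sub>M PiM I M"
  have \<phi>[measurable]: "\<phi> s \<in> ?PP \<rightarrow>\<^sub>M PiM J N" for s
    unfolding \<phi>_def
  proof (rule measurable_restrict)
    fix j assume "j \<in> J"
    then have "fst j \<in> I" by (auto simp: J_def)
    from measurable_component_singleton[OF this, of M]
    have "(\<lambda>\<omega>. fst \<omega> (fst j)) \<in> ?PP \<rightarrow>\<^sub>M M (fst j)" "(\<lambda>\<omega>. snd \<omega> (fst j)) \<in> ?PP \<rightarrow>\<^sub>M M (fst j)"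
      by (auto intro: measurable_compose[OF measurable_fst] measurable_compose[OF measurable_snd])
    then show "(\<lambda>\<omega>. (if snd j \<noteq> (fst j \<in> s) then snd \<omega> else fst \<omega>) (fst j)) \<in> ?PP \<rightarrow>\<^sub>M N j"
      by (cases "snd j \<noteq> (fst j \<in> s)") (simp_all add: N_def)
  qed
  have \<pi>[measurable]: "\<pi> \<in> PiM J N \<rightarrow>\<^sub>M ?PP"
  proof -
    have "(\<lambda>z. \<lambda>i\<in>I. z (i, b)) \<in> PiM J N \<rightarrow>\<^sub>M PiM I M" for b
    proof (rule measurable_restrict)
      fix i assume "i \<in> I"
      then have "(\<lambda>z. z (i, b)) \<in> PiM J N \<rightarrow>\<^sub>M N (i, b)"
        by (intro measurable_component_singleton) (simp add: J_def)
      then show "(\<lambda>z. z (i, b)) \<in> PiM J N \<rightarrow>\<^sub>M M i" by (simp add: N_def)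
    qed
    then show ?thesis unfolding \<pi>_def by (intro measurable_Pair)
  qed
  have distr: "distr ?PP (PiM J N) (\<phi> s) = PiM J N" for s
  proof (rule N.PiM_eqI)
    show finJ: "finite J" using fin by (simp add: J_def)
    fix A assume A: "\<And>j. j \<in> J \<Longrightarrow> A j \<in> sets (N j)"
    have A': "A (i, b) \<in> sets (M i)" if "i \<in> I" for i b
      using A[of "(i, b)"] that by (simp add: N_def J_def)
    have A_sub: "y \<in> space (M i)" if "i \<in> I" "y \<in> A (i, b)" for i b y
      using sets.sets_into_space[OF A'[OF that(1)]] that(2) by blast
    have "\<phi> s -` Pi\<^sub>E J A \<inter> space ?PP = Pi\<^sub>E I (\<lambda>i. A (i, i \<in> s)) \<times> Pi\<^sub>E I (\<lambda>i. A (i, i \<notin> s))"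
      (is "?L = ?R")
    proof (rule set_eqI)
      fix \<omega>
      have "\<omega> \<in> ?L \<longleftrightarrow> \<omega> \<in> space ?PP \<and> (\<forall>i\<in>I. \<forall>b. (if b \<noteq> (i \<in> s) then snd \<omega> else fst \<omega>) i \<in> A (i, b))"
        by (auto simp: \<phi>_def J_def PiE_iff)
      also have "\<dots> \<longleftrightarrow> \<omega> \<in> space ?PP \<and> (\<forall>i\<in>I. fst \<omega> i \<in> A (i, i \<in> s) \<and> snd \<omega> i \<in> A (i, i \<notin> s))"
        by (intro conj_cong refl ball_cong) (auto simp: all_bool_eq)
      also have "\<dots> \<longleftrightarrow> \<omega> \<in> ?R"
        using A_sub by (cases \<omega>) (auto simp: space_pair_measure space_PiM PiE_iff)
      finally show "\<omega> \<in> ?L \<longleftrightarrow> \<omega> \<in> ?R" .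
    qed
    then have "emeasure (distr ?PP (PiM J N) (\<phi> s)) (Pi\<^sub>E J A)
        = emeasure ?PP (Pi\<^sub>E I (\<lambda>i. A (i, i \<in> s)) \<times> Pi\<^sub>E I (\<lambda>i. A (i, i \<notin> s)))"
      using sets_PiM_I_finite[OF finJ A] by (simp add: emeasure_distr[OF \<phi>])
    also have "\<dots> = (\<Prod>i\<in>I. emeasure (M i) (A (i, i \<in> s))) * (\<Prod>i\<in>I. emeasure (M i) (A (i, i \<notin> s)))"
      using fin A' by (subst P.emeasure_pair_measure_Times)
        (auto intro!: sets_PiM_I_finite simp: emeasure_PiM)
    also have "\<dots> = (\<Prod>i\<in>I. \<Prod>b\<in>UNIV. emeasure (N (i, b)) (A (i, b)))"
      unfolding prod.distrib[symmetric]
    proof (intro prod.cong refl)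
      fix i
      show "emeasure (M i) (A (i, i \<in> s)) * emeasure (M i) (A (i, i \<notin> s))
          = (\<Prod>b\<in>UNIV. emeasure (N (i, b)) (A (i, b)))"
        by (cases "i \<in> s") (simp_all add: UNIV_bool N_def mult.commute)
    qed
    also have "\<dots> = (\<Prod>j\<in>J. emeasure (N j) (A j))"
      unfolding J_def by (simp add: prod.cartesian_product)
    finally show "emeasure (distr ?PP (PiM J N) (\<phi> s)) (Pi\<^sub>E J A) = (\<Prod>j\<in>J. emeasure (N j) (A j))" .
  qed simp
  have int: "(\<integral>\<^sup>+\<omega>. H (mix I s (fst \<omega>) (snd \<omega>), mix I s (snd \<omega>) (fst \<omega>)) \<partial>?PP) = (\<integral>\<^sup>+z. H (\<pi> z) \<partial>PiM J N)"
    for s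
  proof -
    have "\<pi> (\<phi> s \<omega>) = (mix I s (fst \<omega>) (snd \<omega>), mix I s (snd \<omega>) (fst \<omega>))" for \<omega>
      by (auto simp: \<pi>_def \<phi>_def mix_def J_def fun_eq_iff)
    then have "(\<integral>\<^sup>+\<omega>. H (mix I s (fst \<omega>) (snd \<omega>), mix I s (snd \<omega>) (fst \<omega>)) \<partial>?PP) = (\<integral>\<^sup>+\<omega>. H (\<pi> (\<phi> s \<omega>)) \<partial>?PP)"
      by simp
    also have "\<dots> = (\<integral>\<^sup>+z. H (\<pi> z) \<partial>distr ?PP (PiM J N) (\<phi> s))"
      by (subst nn_integral_distr) auto
    finally show ?thesis by (simp add: distr)
  qed
  have "(\<integral>\<^sup>+\<omega>. H (mix I {} (fst \<omega>) (snd \<omega>), mix I {} (snd \<omega>) (fst \<omega>)) \<partial>?PP) = (\<integral>\<^sup>+\<omega>. H \<omega> \<partial>?PP)"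
    by (intro nn_integral_cong) (auto simp: mix_def space_pair_measure space_PiM PiE_restrict)
  then show ?thesis using int[of s] int[of "{}"] by simp
qed

text \<open>
  The integral of \<open>H (x, y)\<close> is the average over all \<open>s \<subseteq> I\<close> of the integrals with the coordinates
  in \<open>s\<close> exchanged. For fixed \<open>x\<close> and \<open>y\<close>, the exchanged samples at \<open>s\<close> are the points \<open>s\<close> and
  \<open>I - s\<close> of the cube that \<open>x\<close> and \<open>y\<close> span, so the cube inequality bounds the sum over \<open>s\<close>. Only
  the first sample occurs in that bound, and it has the original law for every \<open>s\<close>.
\<close>
lemma dual_reimer_PiM:
  fixes M :: "'i \<Rightarrow> 'c measure" and I :: "'i set" and A :: "'a set" and B :: "'b set"
    and f :: "'a \<Rightarrow> ('i \<Rightarrow> 'c) \<Rightarrow> ennreal" and g :: "'b \<Rightarrow> ('i \<Rightarrow> 'c) \<Rightarrow> ennreal"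
  assumes M: "product_prob_space M" and fin: "finite I" and cnt: "countable A" "countable B"
    and f_meas: "\<And>a. a \<in> A \<Longrightarrow> f a \<in> borel_measurable (PiM I M)"
    and f: "\<And>a x y. a \<in> A \<Longrightarrow> x \<in> space (PiM I M) \<Longrightarrow> y \<in> space (PiM I M) \<Longrightarrow>
      restrict x (K a) = restrict y (K a) \<Longrightarrow> f a x = f a y"
    and g_meas: "\<And>b. b \<in> B \<Longrightarrow> g b \<in> borel_measurable (PiM I M)"
    and g: "\<And>b x y. b \<in> B \<Longrightarrow> x \<in> space (PiM I M) \<Longrightarrow> y \<in> space (PiM I M) \<Longrightarrow>
      restrict x (L b) = restrict y (L b) \<Longrightarrow> g b x = g b y"
  shows "(\<integral>\<^sup>+\<omega>. (SUP (a, b)\<in>{(a, b). a \<in> A \<and> b \<in> B \<and> K a \<inter> L b = {}}. f a (fst \<omega>) * g b (snd \<omega>))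
      \<partial>(PiM I M \<Otimes>\<^sub>M PiM I M))
    \<le> (\<integral>\<^sup>+x. (SUP a\<in>A. f a x) * (SUP b\<in>B. g b x) \<partial>PiM I M)"
proof -
  interpret product_prob_space M I by fact
  interpret P: prob_space "PiM I M" by (rule prob_space_PiM) (rule M.prob_space_axioms)
  let ?P = "PiM I M"
  let ?PP = "?P \<Otimes>\<^sub>M ?P"
  define D where "D = {(a, b). a \<in> A \<and> b \<in> B \<and> K a \<inter> L b = {}}"
  have D: "countable D" by (rule countable_subset[of _ "A \<times> B"]) (use cnt in \<open>auto simp: D_def\<close>)
  define H where "H \<omega> = (SUP (a, b)\<in>D. f a (fst \<omega>) * g b (snd \<omega>))" for \<omega>
  define \<Phi> where "\<Phi> x = (SUP a\<in>A. f a x) * (SUP b\<in>B. g b x)" for x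
  have H[measurable]: "H \<in> borel_measurable ?PP"
  proof -
    have "(\<lambda>\<omega>. case p of (a, b) \<Rightarrow> f a (fst \<omega>) * g b (snd \<omega>)) \<in> borel_measurable ?PP" if pD: "p \<in> D" for p
    proof -
      obtain a b where p: "p = (a, b)" "a \<in> A" "b \<in> B" using pD unfolding D_def by blast
      note [measurable] = f_meas[OF p(2)] g_meas[OF p(3)]
      show ?thesis unfolding p(1) by simp
    qed
    then show ?thesis unfolding H_def using D by (intro borel_measurable_SUP) auto
  qed
  have \<Phi>[measurable]: "\<Phi> \<in> borel_measurable ?P"
    unfolding \<Phi>_def using cnt f_meas g_meas
    by (intro borel_measurable_times_ennreal borel_measurable_SUP) auto
  define S where "S s \<omega> = mix I s (fst \<omega>) (snd \<omega>)" for s and \<omega> :: "('i \<Rightarrow> 'c) \<times> ('i \<Rightarrow> 'c)"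
  define S' where "S' s \<omega> = mix I s (snd \<omega>) (fst \<omega>)" for s and \<omega> :: "('i \<Rightarrow> 'c) \<times> ('i \<Rightarrow> 'c)"
  have [measurable]: "S s \<in> ?PP \<rightarrow>\<^sub>M ?P" "S' s \<in> ?PP \<rightarrow>\<^sub>M ?P" for s
    unfolding S_def S'_def by measurable
  have pointwise: "(\<Sum>s\<in>Pow I. H (S s \<omega>, S' s \<omega>)) \<le> (\<Sum>s\<in>Pow I. \<Phi> (S s \<omega>))" if \<omega>: "\<omega> \<in> space ?PP" for \<omega>
  proof -
    have sp: "S s \<omega> \<in> space ?P" for s using \<omega> by (rule measurable_space[rotated]) measurable
    have S': "S' s \<omega> = S (I - s) \<omega>" for s
      by (auto simp: S_def S'_def mix_def fun_eq_iff)
    have restr: "restrict (S x \<omega>) C = restrict (S y \<omega>) C" if "x \<inter> C = y \<inter> C" for x y C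
      using that by (auto simp: S_def mix_def fun_eq_iff restrict_def)
    have "(\<Sum>x\<in>Pow I. SUP (a, b)\<in>D. f a (S x \<omega>) * g b (S (I - x) \<omega>))
        \<le> (\<Sum>x\<in>Pow I. (SUP a\<in>A. f a (S x \<omega>)) * (SUP b\<in>B. g b (S x \<omega>)))"
      unfolding D_def
      by (rule dual_reimer_cube[OF fin cnt]) (rule f g, assumption, rule sp, rule sp, rule restr, assumption)+
    then show ?thesis by (simp add: H_def \<Phi>_def S')
  qed
  let ?c = "of_nat (card (Pow I)) :: ennreal"
  have "?c * (\<integral>\<^sup>+\<omega>. H \<omega> \<partial>?PP) = (\<Sum>s\<in>Pow I. \<integral>\<^sup>+\<omega>. H (S s \<omega>, S' s \<omega>) \<partial>?PP)"
    unfolding S_def S'_def by (subst nn_integral_mix[OF M fin H]) simp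
  also have "\<dots> = (\<integral>\<^sup>+\<omega>. (\<Sum>s\<in>Pow I. H (S s \<omega>, S' s \<omega>)) \<partial>?PP)"
    by (subst nn_integral_sum) auto
  also have "\<dots> \<le> (\<integral>\<^sup>+\<omega>. (\<Sum>s\<in>Pow I. \<Phi> (S s \<omega>)) \<partial>?PP)"
    by (intro nn_integral_mono pointwise)
  also have "\<dots> = (\<Sum>s\<in>Pow I. \<integral>\<^sup>+\<omega>. \<Phi> (S s \<omega>) \<partial>?PP)"
    by (subst nn_integral_sum) auto
  also have "\<dots> = (\<Sum>s\<in>Pow I. \<integral>\<^sup>+\<omega>. \<Phi> (fst \<omega>) \<partial>?PP)"
    using nn_integral_mix[OF M fin, of "\<lambda>\<omega>. \<Phi> (fst \<omega>)"] by (simp add: S_def)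
  also have "\<dots> = ?c * (\<integral>\<^sup>+\<omega>. \<Phi> (fst \<omega>) \<partial>?PP)" by simp
  also have "(\<integral>\<^sup>+\<omega>. \<Phi> (fst \<omega>) \<partial>?PP) = (\<integral>\<^sup>+x. \<Phi> x \<partial>?P)"
    by (subst P.nn_integral_fst[symmetric]) (auto simp: P.emeasure_space_1)
  finally have "?c * (\<integral>\<^sup>+\<omega>. H \<omega> \<partial>?PP) \<le> ?c * (\<integral>\<^sup>+x. \<Phi> x \<partial>?P)" .
  moreover have "?c \<noteq> 0" "?c \<noteq> top" using fin by (auto simp: card_eq_0_iff)
  ultimately have "(\<integral>\<^sup>+\<omega>. H \<omega> \<partial>?PP) \<le> (\<integral>\<^sup>+x. \<Phi> x \<partial>?P)"
    by (metis ennreal_mult_le_mult_iff)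
  then show ?thesis by (simp add: H_def \<Phi>_def D_def)
qed

section \<open>Essential infima and lower envelopes\<close>

text \<open>
  Restricting to rational thresholds makes the essential infimum accessible to countable
  operations; both its measurability and the fact that it is an almost everywhere lower bound
  come from here.
\<close>
lemma less_ess_inf_iff:
  "c < ess_inf N h \<longleftrightarrow> (\<exists>r::rat. c < ennreal (real_of_rat r) \<and> (AE z in N. ennreal (real_of_rat r) \<le> h z))"
proof
  assume "c < ess_inf N h"
  then obtain d where d: "c < d" "AE z in N. d \<le> h z"
    unfolding ess_inf_def less_Sup_iff by auto
  obtain r :: rat where r: "c < ennreal (real_of_rat r)" "ennreal (real_of_rat r) < d"
    using ennreal_rat_dense[OF d(1)] by blast
  have "AE z in N. ennreal (real_of_rat r) \<le> h z"
    using d(2) by eventually_elim (use r in auto)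
  with r show "\<exists>r::rat. c < ennreal (real_of_rat r) \<and> (AE z in N. ennreal (real_of_rat r) \<le> h z)"
    by blast
qed (auto simp: ess_inf_def less_Sup_iff)

lemma AE_ess_inf_le: "AE z in N. ess_inf N h \<le> h z"
proof -
  have "AE z in N. (\<forall>r::rat. (AE z in N. ennreal (real_of_rat r) \<le> h z) \<longrightarrow> ennreal (real_of_rat r) \<le> h z)"
    by (subst AE_all_countable) auto
  then show ?thesis
  proof eventually_elim
    case (elim z)
    show ?case
    proof (rule ccontr)
      assume "\<not> ?thesis"
      then obtain r :: rat where "h z < ennreal (real_of_rat r)" "AE z in N. ennreal (real_of_rat r) \<le> h z"
        using less_ess_inf_iff[of "h z" N h] by auto
      with elim show False by (metis leD)
    qed
  qed
qed

lemma measurable_ess_inf: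
  assumes "sigma_finite_measure N"
    and h[measurable]: "case_prod h \<in> borel_measurable (M \<Otimes>\<^sub>M N)"
  shows "(\<lambda>x. ess_inf N (h x)) \<in> borel_measurable M"
proof (rule borel_measurableI_greater)
  interpret sigma_finite_measure N by fact
  fix c :: ennreal
  have AE_sets: "{x \<in> space M. AE z in N. d \<le> h x z} \<in> sets M" for d :: ennreal
  proof -
    have "{x \<in> space M. AE z in N. d \<le> h x z}
        = {x \<in> space M. emeasure N {z \<in> space N. \<not> d \<le> h x z} = 0}"
    proof (intro Collect_cong conj_cong refl)
      fix x assume [measurable]: "x \<in> space M"
      have "{z \<in> space N. \<not> d \<le> h x z} \<in> sets N" by measurable
      then show "(AE z in N. d \<le> h x z) \<longleftrightarrow> emeasure N {z \<in> space N. \<not> d \<le> h x z} = 0"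
        by (intro AE_iff_measurable) auto
    qed
    also have "\<dots> \<in> sets M" by measurable
    finally show ?thesis .
  qed
  have "{x \<in> space M. c < ess_inf N (h x)}
      = (\<Union>r\<in>{r::rat. c < ennreal (real_of_rat r)}. {x \<in> space M. AE z in N. ennreal (real_of_rat r) \<le> h x z})"
    by (auto simp: less_ess_inf_iff)
  also have "\<dots> \<in> sets M" using AE_sets by (intro sets.countable_UN') auto
  finally show "{x \<in> space M. c < ess_inf N (h x)} \<in> sets M" .
qed

text \<open>
  The lower envelope for a product measure, whose marginal on \<open>I - K\<close> is again a product measure.
\<close>
definition product_lower_env :: "'i set \<Rightarrow> ('i \<Rightarrow> 'a measure) \<Rightarrow> (('i \<Rightarrow> 'a) \<Rightarrow> ennreal) \<Rightarrow> 'i set \<Rightarrow> ('i \<Rightarrow> 'a) \<Rightarrow> ennreal" where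
  "product_lower_env I M h K x = ess_inf (PiM (I - K) M) (\<lambda>z. h (merge K (I - K) (x, z)))"

lemma product_lower_env_cong: "restrict x K = restrict y K \<Longrightarrow> product_lower_env I M h K x = product_lower_env I M h K y"
proof -
  assume "restrict x K = restrict y K"
  then have "x i = y i" if "i \<in> K" for i using that by (metis restrict_apply')
  then have "merge K (I - K) (x, z) = merge K (I - K) (y, z)" for z
    by (auto simp: merge_def fun_eq_iff)
  then show ?thesis by (simp add: product_lower_env_def)
qed

lemma measurable_product_lower_env:
  fixes M :: "'i \<Rightarrow> 'c measure"
  assumes "product_prob_space M" and "K \<subseteq> I"
    and h[measurable]: "h \<in> borel_measurable (PiM I M)"
  shows "product_lower_env I M h K \<in> borel_measurable (PiM I M)"
  unfolding product_lower_env_def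
proof (rule measurable_ess_inf)
  interpret product_prob_space M I by fact
  show "sigma_finite_measure (PiM (I - K) M)"
    by (intro prob_space_imp_sigma_finite prob_space_PiM M.prob_space_axioms)
  have "(\<lambda>p. (restrict (fst p) K, snd p)) \<in> PiM I M \<Otimes>\<^sub>M PiM (I - K) M \<rightarrow>\<^sub>M PiM K M \<Otimes>\<^sub>M PiM (I - K) M"
    using \<open>K \<subseteq> I\<close> by (intro measurable_Pair measurable_compose[OF measurable_fst] measurable_restrict_subset) auto
  from measurable_compose[OF this measurable_merge]
  have "(\<lambda>p. merge K (I - K) (restrict (fst p) K, snd p)) \<in> PiM I M \<Otimes>\<^sub>M PiM (I - K) M \<rightarrow>\<^sub>M PiM I M"
    using \<open>K \<subseteq> I\<close> by (simp add: Un_absorb1)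
  also have "(\<lambda>p. merge K (I - K) (restrict (fst p) K, snd p)) = merge K (I - K)"
    by (auto simp: merge_def fun_eq_iff)
  finally have [measurable]: "merge K (I - K) \<in> PiM I M \<Otimes>\<^sub>M PiM (I - K) M \<rightarrow>\<^sub>M PiM I M" .
  have "(\<lambda>p. h (merge K (I - K) p)) \<in> borel_measurable (PiM I M \<Otimes>\<^sub>M PiM (I - K) M)" by measurable
  then show "(\<lambda>(x, z). h (merge K (I - K) (x, z))) \<in> borel_measurable (PiM I M \<Otimes>\<^sub>M PiM (I - K) M)"
    by (simp add: case_prod_beta')
qed

text \<open>
  A sample of the product measure is a merge of independent samples \<open>x\<close> on \<open>K\<close> and \<open>z\<close> on \<open>I - K\<close>. The
  envelope sees only \<open>x\<close>, and for each \<open>x\<close> it is a lower bound for almost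
  every \<open>z\<close> by \<open>AE_ess_inf_le\<close>.
\<close>
lemma AE_product_lower_env_le:
  fixes M :: "'i \<Rightarrow> 'c measure"
  assumes M: "product_prob_space M" and fin: "finite I" and K: "K \<subseteq> I"
    and h[measurable]: "h \<in> borel_measurable (PiM I M)"
  shows "AE x in PiM I M. product_lower_env I M h K x \<le> h x"
proof -
  interpret product_prob_space M I by fact
  have "prob_space (PiM K M)" "prob_space (PiM (I - K) M)"
    by (rule prob_space_PiM, rule M.prob_space_axioms)+
  then interpret PQ: pair_sigma_finite "PiM K M" "PiM (I - K) M"
    by (intro pair_sigma_finite.intro prob_space_imp_sigma_finite)
  note [measurable] = measurable_product_lower_env[OF M K h]
  have I: "K \<union> (I - K) = I" using K by auto
  have [measurable]: "merge K (I - K) \<in> PiM K M \<Otimes>\<^sub>M PiM (I - K) M \<rightarrow>\<^sub>M PiM I M"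
    using measurable_merge[of K "I - K" M] unfolding I .
  have "AE x in PiM K M. AE z in PiM (I - K) M.
      product_lower_env I M h K (merge K (I - K) (x, z)) \<le> h (merge K (I - K) (x, z))"
  proof (rule AE_I2)
    fix x
    have "product_lower_env I M h K (merge K (I - K) (x, z)) = product_lower_env I M h K x" for z
      by (rule product_lower_env_cong) (auto simp: merge_def fun_eq_iff)
    then show "AE z in PiM (I - K) M. product_lower_env I M h K (merge K (I - K) (x, z)) \<le> h (merge K (I - K) (x, z))"
      using AE_ess_inf_le[of "PiM (I - K) M" "\<lambda>z. h (merge K (I - K) (x, z))"] by (simp add: product_lower_env_def)
  qed
  then have "AE p in PiM K M \<Otimes>\<^sub>M PiM (I - K) M. product_lower_env I M h K (merge K (I - K) p) \<le> h (merge K (I - K) p)"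
    by (intro PQ.AE_pair_measure) measurable
  then have "AE x in distr (PiM K M \<Otimes>\<^sub>M PiM (I - K) M) (PiM I M) (merge K (I - K)). product_lower_env I M h K x \<le> h x"
    by (subst AE_distr_iff) measurable
  also have "distr (PiM K M \<Otimes>\<^sub>M PiM (I - K) M) (PiM I M) (merge K (I - K)) = PiM I M"
    using distr_merge[of K "I - K"] fin finite_subset[OF K fin] unfolding I by simp
  finally show ?thesis .
qed

lemma dual_reimer_lower_env:
  fixes M :: "'i \<Rightarrow> 'c measure"
  assumes M: "product_prob_space M" and fin: "finite I"
    and f[measurable]: "f \<in> borel_measurable (PiM I M)" and g[measurable]: "g \<in> borel_measurable (PiM I M)"
    and KL: "\<K> \<subseteq> Pow I" "\<L> \<subseteq> Pow I"
  shows "(\<integral>\<^sup>+\<omega>. (SUP (K, L)\<in>{(K, L). K \<in> \<K> \<and> L \<in> \<L> \<and> K \<inter> L = {}}.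
      product_lower_env I M f K (fst \<omega>) * product_lower_env I M g L (snd \<omega>)) \<partial>(PiM I M \<Otimes>\<^sub>M PiM I M))
    \<le> (\<integral>\<^sup>+x. f x * g x \<partial>PiM I M)"
proof -
  have cnt: "countable \<K>" "countable \<L>"
    using KL fin by (meson countable_finite finite_Pow_iff finite_subset)+
  have "(\<integral>\<^sup>+\<omega>. (SUP (K, L)\<in>{(K, L). K \<in> \<K> \<and> L \<in> \<L> \<and> id K \<inter> id L = {}}.
      product_lower_env I M f K (fst \<omega>) * product_lower_env I M g L (snd \<omega>)) \<partial>(PiM I M \<Otimes>\<^sub>M PiM I M))
    \<le> (\<integral>\<^sup>+x. (SUP K\<in>\<K>. product_lower_env I M f K x) * (SUP L\<in>\<L>. product_lower_env I M g L x) \<partial>PiM I M)"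
  proof (rule dual_reimer_PiM[OF M fin cnt])
    show "product_lower_env I M f K \<in> borel_measurable (PiM I M)" if "K \<in> \<K>" for K
      using that KL by (intro measurable_product_lower_env M f) auto
    show "product_lower_env I M g L \<in> borel_measurable (PiM I M)" if "L \<in> \<L>" for L
      using that KL by (intro measurable_product_lower_env M g) auto
    show "product_lower_env I M f K x = product_lower_env I M f K y" if "restrict x (id K) = restrict y (id K)" for K x y
      using product_lower_env_cong[of x K y I M f] that by simp
    show "product_lower_env I M g L x = product_lower_env I M g L y" if "restrict x (id L) = restrict y (id L)" for L x y
      using product_lower_env_cong[of x L y I M g] that by simp
  qed
  also have "\<dots> \<le> (\<integral>\<^sup>+x. f x * g x \<partial>PiM I M)"
  proof (rule nn_integral_mono_AE)
    have "AE x in PiM I M. \<forall>K\<in>\<K>. product_lower_env I M f K x \<le> f x"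
      unfolding AE_ball_countable[OF cnt(1)] using KL by (intro ballI AE_product_lower_env_le M fin f) auto
    moreover have "AE x in PiM I M. \<forall>L\<in>\<L>. product_lower_env I M g L x \<le> g x"
      unfolding AE_ball_countable[OF cnt(2)] using KL by (intro ballI AE_product_lower_env_le M fin g) auto
    ultimately show "AE x in PiM I M. (SUP K\<in>\<K>. product_lower_env I M f K x) * (SUP L\<in>\<L>. product_lower_env I M g L x) \<le> f x * g x"
      by eventually_elim (intro mult_mono SUP_least, auto)
  qed
  finally show ?thesis by simp
qed

section \<open>Independent random vectors\<close>

theorem theorem1p5:
  fixes n :: nat
    and M :: "nat \<Rightarrow> 'a measure"
    and P :: "(nat \<Rightarrow> 'a) measure"
    and \<Omega> :: "'w measure"
    and X Y :: "'w \<Rightarrow> nat \<Rightarrow> 'a"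
  assumes "n \<ge> 1"
    and "prob_space \<Omega>"
    and "X \<in> \<Omega> \<rightarrow>\<^sub>M PiM {1..n} M"
    and "P = distr \<Omega> (PiM {1..n} M) X"
    and "prob_space.indep_vars \<Omega> M (\<lambda>i \<omega>. X \<omega> i) {1..n}"
    and "Y \<in> \<Omega> \<rightarrow>\<^sub>M PiM {1..n} M"
    and "distr \<Omega> (PiM {1..n} M) Y = P"
    and "prob_space.indep_var \<Omega> (PiM {1..n} M) X (PiM {1..n} M) Y"
  shows
    "(\<forall>(A :: 'i set) (B :: 'j set)
        (f :: 'i \<Rightarrow> (nat \<Rightarrow> 'a) \<Rightarrow> real) (g :: 'j \<Rightarrow> (nat \<Rightarrow> 'a) \<Rightarrow> real)
        (K :: 'i \<Rightarrow> nat set) (L :: 'j \<Rightarrow> nat set).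
        countable A \<longrightarrow> countable B \<longrightarrow>
        (\<forall>\<alpha>\<in>A. f \<alpha> \<in> borel_measurable (PiM {1..n} M)
               \<and> (\<forall>x\<in>space (PiM {1..n} M). 0 \<le> f \<alpha> x)
               \<and> K \<alpha> \<subseteq> {1..n} \<and> depends_on (space (PiM {1..n} M)) (f \<alpha>) (K \<alpha>)) \<longrightarrow>
        (\<forall>\<beta>\<in>B. g \<beta> \<in> borel_measurable (PiM {1..n} M)
               \<and> (\<forall>x\<in>space (PiM {1..n} M). 0 \<le> g \<beta> x)
               \<and> L \<beta> \<subseteq> {1..n} \<and> depends_on (space (PiM {1..n} M)) (g \<beta>) (L \<beta>)) \<longrightarrow>
        (\<integral>\<^sup>+\<omega>. (SUP (\<alpha>, \<beta>)\<in>{(\<alpha>, \<beta>). \<alpha> \<in> A \<and> \<beta> \<in> B \<and> K \<alpha> \<inter> L \<beta> = {}}.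
                 ennreal (f \<alpha> (X \<omega>) * g \<beta> (Y \<omega>))) \<partial>\<Omega>)
        \<le> (\<integral>\<^sup>+\<omega>. (SUP (\<alpha>, \<beta>)\<in>A \<times> B. ennreal (f \<alpha> (X \<omega>) * g \<beta> (X \<omega>))) \<partial>\<Omega>))
     \<and>
     (\<forall>(f :: (nat \<Rightarrow> 'a) \<Rightarrow> real) (g :: (nat \<Rightarrow> 'a) \<Rightarrow> real)
        (\<K> :: nat set set) (\<L> :: nat set set).
        f \<in> borel_measurable (PiM {1..n} M) \<longrightarrow>
        (\<forall>x\<in>space (PiM {1..n} M). 0 \<le> f x) \<longrightarrow>
        g \<in> borel_measurable (PiM {1..n} M) \<longrightarrow>
        (\<forall>x\<in>space (PiM {1..n} M). 0 \<le> g x) \<longrightarrow>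
        \<K> \<subseteq> Pow {1..n} \<longrightarrow> \<L> \<subseteq> Pow {1..n} \<longrightarrow>
        (\<integral>\<^sup>+\<omega>. (SUP (K, L)\<in>{(K, L). K \<in> \<K> \<and> L \<in> \<L> \<and> K \<inter> L = {}}.
                 lower_env {1..n} M P f K (X \<omega>) * lower_env {1..n} M P g L (Y \<omega>)) \<partial>\<Omega>)
        \<le> (\<integral>\<^sup>+\<omega>. ennreal (f (X \<omega>) * g (X \<omega>)) \<partial>\<Omega>))"
proof (intro conjI allI impI)
  \<comment> \<open>Keeps the index set \<open>{1..n}\<close> in the form in which all facts are stated.\<close>
  note One_nat_def [simp del]
  interpret prob_space \<Omega> by fact
  let ?I = "{1..n}"
  \<comment> \<open>The marginals of \<open>X\<close>. The value outside the index set is an arbitrary probability measure, so that \<open>N\<close> is a family of probability measures on all of \<open>nat\<close>.\<close>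
  define N where "N i = (if i \<in> ?I then distr \<Omega> (M i) (\<lambda>\<omega>. X \<omega> i)
    else return (count_space UNIV) undefined)" for i
  note X[measurable] = \<open>X \<in> \<Omega> \<rightarrow>\<^sub>M PiM ?I M\<close> and Y[measurable] = \<open>Y \<in> \<Omega> \<rightarrow>\<^sub>M PiM ?I M\<close>
  have Xi[measurable]: "(\<lambda>\<omega>. X \<omega> i) \<in> \<Omega> \<rightarrow>\<^sub>M M i" if "i \<in> ?I" for i
    using measurable_compose[OF X measurable_component_singleton[OF that]] .
  have N: "product_prob_space N"
  proof -
    have "prob_space (N i)" for i
      by (auto simp: N_def intro!: prob_space_distr Xi prob_space_return)
    then show ?thesis
      by (simp add: product_prob_space_def product_prob_space_axioms_def product_sigma_finite_def
          prob_space_imp_sigma_finite)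
  qed
  have sets_N: "sets (PiM J N) = sets (PiM J M)" if "J \<subseteq> ?I" for J
    using that by (intro sets_PiM_cong) (auto simp: N_def)
  have space_N: "space (PiM ?I N) = space (PiM ?I M)"
    by (rule sets_eq_imp_space_eq) (simp add: sets_N)
  have P: "P = PiM ?I N"
  proof -
    have "distr \<Omega> (PiM ?I M) (\<lambda>\<omega>. \<lambda>i\<in>?I. X \<omega> i) = PiM ?I (\<lambda>i. distr \<Omega> (M i) (\<lambda>\<omega>. X \<omega> i))"
      using indep_vars_iff_distr_eq_PiM'[of ?I "\<lambda>i \<omega>. X \<omega> i" M] Xi assms(1,5) by auto
    also have "PiM ?I (\<lambda>i. distr \<Omega> (M i) (\<lambda>\<omega>. X \<omega> i)) = PiM ?I N"
      by (intro PiM_cong) (auto simp: N_def)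
    also have "distr \<Omega> (PiM ?I M) (\<lambda>\<omega>. \<lambda>i\<in>?I. X \<omega> i) = P"
      unfolding assms(4)
    proof (intro distr_cong refl)
      fix \<omega> assume "\<omega> \<in> space \<Omega>"
      from measurable_space[OF X this] show "(\<lambda>i\<in>?I. X \<omega> i) = X \<omega>"
        by (simp add: space_PiM PiE_restrict)
    qed
    finally show ?thesis by simp
  qed
  have XY: "(\<lambda>\<omega>. (X \<omega>, Y \<omega>)) \<in> \<Omega> \<rightarrow>\<^sub>M PiM ?I M \<Otimes>\<^sub>M PiM ?I M" by measurable
  have pair: "distr \<Omega> (PiM ?I M \<Otimes>\<^sub>M PiM ?I M) (\<lambda>\<omega>. (X \<omega>, Y \<omega>)) = PiM ?I N \<Otimes>\<^sub>M PiM ?I N"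
    using assms(8) unfolding indep_var_distribution_eq assms(7) assms(4)[symmetric] P by simp
  have int_XY: "(\<integral>\<^sup>+\<omega>. H (X \<omega>, Y \<omega>) \<partial>\<Omega>) = (\<integral>\<^sup>+p. H p \<partial>(PiM ?I N \<Otimes>\<^sub>M PiM ?I N))"
    if "H \<in> borel_measurable (PiM ?I N \<Otimes>\<^sub>M PiM ?I N)" for H
  proof -
    have "H \<in> borel_measurable (PiM ?I M \<Otimes>\<^sub>M PiM ?I M)"
      using that by (simp add: measurable_cong_sets[OF sets_pair_measure_cong[OF sets_N sets_N] refl])
    then show ?thesis unfolding pair[symmetric] using XY by (subst nn_integral_distr) auto
  qed
  have int_X: "(\<integral>\<^sup>+\<omega>. H (X \<omega>) \<partial>\<Omega>) = (\<integral>\<^sup>+x. H x \<partial>PiM ?I N)"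
    if "H \<in> borel_measurable (PiM ?I N)" for H
  proof -
    have "H \<in> borel_measurable (PiM ?I M)"
      using that by (simp add: measurable_cong_sets[OF sets_N refl])
    then show ?thesis unfolding P[symmetric] assms(4) using X by (subst nn_integral_distr) auto
  qed
  have sp: "X \<omega> \<in> space (PiM ?I N)" "Y \<omega> \<in> space (PiM ?I N)" if "\<omega> \<in> space \<Omega>" for \<omega>
    using that measurable_space[OF X] measurable_space[OF Y] by (auto simp: space_N)
  have meas_N: "f \<in> borel_measurable (PiM ?I N) \<longleftrightarrow> f \<in> borel_measurable (PiM ?I M)"
    for f :: "(nat \<Rightarrow> 'a) \<Rightarrow> real"
    by (rule arg_cong[where f="\<lambda>A. f \<in> A"], rule measurable_cong_sets) (simp_all add: sets_N)

  {
    fix A :: "'i set" and B :: "'j set" and f :: "'i \<Rightarrow> (nat \<Rightarrow> 'a) \<Rightarrow> real"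
      and g :: "'j \<Rightarrow> (nat \<Rightarrow> 'a) \<Rightarrow> real" and K :: "'i \<Rightarrow> nat set" and L :: "'j \<Rightarrow> nat set"
    assume cnt: "countable A" "countable B"
      and f: "\<forall>\<alpha>\<in>A. f \<alpha> \<in> borel_measurable (PiM ?I M) \<and> (\<forall>x\<in>space (PiM ?I M). 0 \<le> f \<alpha> x)
               \<and> K \<alpha> \<subseteq> ?I \<and> depends_on (space (PiM ?I M)) (f \<alpha>) (K \<alpha>)"
      and g: "\<forall>\<beta>\<in>B. g \<beta> \<in> borel_measurable (PiM ?I M) \<and> (\<forall>x\<in>space (PiM ?I M). 0 \<le> g \<beta> x)
               \<and> L \<beta> \<subseteq> ?I \<and> depends_on (space (PiM ?I M)) (g \<beta>) (L \<beta>)"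
    define D where "D = {(\<alpha>, \<beta>). \<alpha> \<in> A \<and> \<beta> \<in> B \<and> K \<alpha> \<inter> L \<beta> = {}}"
    have D: "countable D" "D \<subseteq> A \<times> B"
      using countable_subset[of D "A \<times> B"] cnt by (auto simp: D_def)
    have f_meas: "(\<lambda>x. ennreal (f \<alpha> x)) \<in> borel_measurable (PiM ?I N)" if "\<alpha> \<in> A" for \<alpha>
      using f that by (intro measurable_compose[OF _ measurable_ennreal]) (simp add: meas_N)
    have g_meas: "(\<lambda>x. ennreal (g \<beta> x)) \<in> borel_measurable (PiM ?I N)" if "\<beta> \<in> B" for \<beta>
      using g that by (intro measurable_compose[OF _ measurable_ennreal]) (simp add: meas_N)
    define H where "H p = (SUP (\<alpha>, \<beta>)\<in>D. ennreal (f \<alpha> (fst p)) * ennreal (g \<beta> (snd p)))" for p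
    have H: "H \<in> borel_measurable (PiM ?I N \<Otimes>\<^sub>M PiM ?I N)"
      unfolding H_def
    proof (rule borel_measurable_SUP[OF D(1)])
      fix q assume "q \<in> D"
      then obtain \<alpha> \<beta> where q: "q = (\<alpha>, \<beta>)" "\<alpha> \<in> A" "\<beta> \<in> B" using D(2) by blast
      note [measurable] = f_meas[OF q(2)] g_meas[OF q(3)]
      show "(\<lambda>p. case q of (\<alpha>, \<beta>) \<Rightarrow> ennreal (f \<alpha> (fst p)) * ennreal (g \<beta> (snd p)))
          \<in> borel_measurable (PiM ?I N \<Otimes>\<^sub>M PiM ?I N)"
        unfolding q(1) by simp
    qed
    have "(\<integral>\<^sup>+\<omega>. (SUP (\<alpha>, \<beta>)\<in>D. ennreal (f \<alpha> (X \<omega>) * g \<beta> (Y \<omega>))) \<partial>\<Omega>) = (\<integral>\<^sup>+\<omega>. H (X \<omega>, Y \<omega>) \<partial>\<Omega>)"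
      unfolding H_def
      by (intro nn_integral_cong SUP_cong refl)
         (use f D(2) sp in \<open>auto simp: ennreal_mult' space_N\<close>)
    also have "\<dots> = (\<integral>\<^sup>+p. H p \<partial>(PiM ?I N \<Otimes>\<^sub>M PiM ?I N))" by (rule int_XY[OF H])
    also have "\<dots> \<le> (\<integral>\<^sup>+x. (SUP \<alpha>\<in>A. ennreal (f \<alpha> x)) * (SUP \<beta>\<in>B. ennreal (g \<beta> x)) \<partial>PiM ?I N)"
      unfolding H_def D_def
    proof (rule dual_reimer_PiM[OF N finite_atLeastAtMost cnt])
      show "ennreal (f \<alpha> x) = ennreal (f \<alpha> y)"
        if "\<alpha> \<in> A" "x \<in> space (PiM ?I N)" "y \<in> space (PiM ?I N)" "restrict x (K \<alpha>) = restrict y (K \<alpha>)" for \<alpha> x y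
        using f that unfolding depends_on_def space_N by metis
      show "ennreal (g \<beta> x) = ennreal (g \<beta> y)"
        if "\<beta> \<in> B" "x \<in> space (PiM ?I N)" "y \<in> space (PiM ?I N)" "restrict x (L \<beta>) = restrict y (L \<beta>)" for \<beta> x y
        using g that unfolding depends_on_def space_N by metis
    qed (rule f_meas g_meas, assumption)+
    also have "\<dots> = (\<integral>\<^sup>+\<omega>. (SUP \<alpha>\<in>A. ennreal (f \<alpha> (X \<omega>))) * (SUP \<beta>\<in>B. ennreal (g \<beta> (X \<omega>))) \<partial>\<Omega>)"
      by (subst int_X[symmetric])
         (intro borel_measurable_times_ennreal borel_measurable_SUP cnt f_meas g_meas, auto)
    also have "\<dots> = (\<integral>\<^sup>+\<omega>. (SUP (\<alpha>, \<beta>)\<in>A \<times> B. ennreal (f \<alpha> (X \<omega>) * g \<beta> (X \<omega>))) \<partial>\<Omega>)"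
    proof (rule nn_integral_cong)
      fix \<omega> assume "\<omega> \<in> space \<Omega>"
      then have "(SUP (\<alpha>, \<beta>)\<in>A \<times> B. ennreal (f \<alpha> (X \<omega>) * g \<beta> (X \<omega>)))
          = (SUP (\<alpha>, \<beta>)\<in>A \<times> B. ennreal (f \<alpha> (X \<omega>)) * ennreal (g \<beta> (X \<omega>)))"
        using f sp by (intro SUP_cong refl) (auto simp: ennreal_mult' space_N)
      then show "(SUP \<alpha>\<in>A. ennreal (f \<alpha> (X \<omega>))) * (SUP \<beta>\<in>B. ennreal (g \<beta> (X \<omega>)))
          = (SUP (\<alpha>, \<beta>)\<in>A \<times> B. ennreal (f \<alpha> (X \<omega>) * g \<beta> (X \<omega>)))"
        by (simp add: SUP_Times_mult_ennreal)
    qed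
    finally show "(\<integral>\<^sup>+\<omega>. (SUP (\<alpha>, \<beta>)\<in>{(\<alpha>, \<beta>). \<alpha> \<in> A \<and> \<beta> \<in> B \<and> K \<alpha> \<inter> L \<beta> = {}}.
                 ennreal (f \<alpha> (X \<omega>) * g \<beta> (Y \<omega>))) \<partial>\<Omega>)
        \<le> (\<integral>\<^sup>+\<omega>. (SUP (\<alpha>, \<beta>)\<in>A \<times> B. ennreal (f \<alpha> (X \<omega>) * g \<beta> (X \<omega>))) \<partial>\<Omega>)"
      unfolding D_def .
  next
    fix f g :: "(nat \<Rightarrow> 'a) \<Rightarrow> real" and \<K> \<L> :: "nat set set"
    assume f: "f \<in> borel_measurable (PiM ?I M)" and f0: "\<forall>x\<in>space (PiM ?I M). 0 \<le> f x"
      and g: "g \<in> borel_measurable (PiM ?I M)" and g0: "\<forall>x\<in>space (PiM ?I M). 0 \<le> g x"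
      and KL: "\<K> \<subseteq> Pow ?I" "\<L> \<subseteq> Pow ?I"
    define e where "e h = product_lower_env ?I N (\<lambda>x. ennreal (h x))" for h :: "(nat \<Rightarrow> 'a) \<Rightarrow> real"
    have lower: "lower_env ?I M P h K = e h K" if "K \<subseteq> ?I" for h K
    proof -
      interpret N: product_prob_space N ?I by (rule N)
      have "marginal M P (?I - K) = distr (PiM ?I N) (PiM (?I - K) N) (\<lambda>x. restrict x (?I - K))"
        unfolding marginal_def P by (intro distr_cong refl) (simp_all add: sets_N)
      also have "\<dots> = PiM (?I - K) N" by (rule N.distr_PiM_restrict_finite) auto
      finally show ?thesis unfolding lower_env_def product_lower_env_def e_def by auto
    qed
    have f_meas: "(\<lambda>x. ennreal (f x)) \<in> borel_measurable (PiM ?I N)"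
      using f by (intro measurable_compose[OF _ measurable_ennreal]) (simp add: meas_N)
    have g_meas: "(\<lambda>x. ennreal (g x)) \<in> borel_measurable (PiM ?I N)"
      using g by (intro measurable_compose[OF _ measurable_ennreal]) (simp add: meas_N)
    define D where "D = {(K, L). K \<in> \<K> \<and> L \<in> \<L> \<and> K \<inter> L = {}}"
    have D: "D \<subseteq> \<K> \<times> \<L>" by (auto simp: D_def)
    have "countable D"
      using D KL by (intro countable_finite finite_subset[of D "Pow ?I \<times> Pow ?I"]) auto
    define H where "H p = (SUP (K, L)\<in>D. e f K (fst p) * e g L (snd p))" for p
    have H: "H \<in> borel_measurable (PiM ?I N \<Otimes>\<^sub>M PiM ?I N)"
      unfolding H_def
    proof (rule borel_measurable_SUP[OF \<open>countable D\<close>])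
      fix q assume "q \<in> D"
      moreover obtain K L where q: "q = (K, L)" by (cases q)
      ultimately have KL_sub: "K \<subseteq> ?I" "L \<subseteq> ?I" using KL by (auto simp: D_def)
      have [measurable]: "e f K \<in> borel_measurable (PiM ?I N)" "e g L \<in> borel_measurable (PiM ?I N)"
        unfolding e_def by (intro measurable_product_lower_env N f_meas g_meas KL_sub)+
      show "(\<lambda>p. case q of (K, L) \<Rightarrow> e f K (fst p) * e g L (snd p))
          \<in> borel_measurable (PiM ?I N \<Otimes>\<^sub>M PiM ?I N)"
        unfolding q by simp
    qed
    have "(\<integral>\<^sup>+\<omega>. (SUP (K, L)\<in>D. lower_env ?I M P f K (X \<omega>) * lower_env ?I M P g L (Y \<omega>)) \<partial>\<Omega>)
        = (\<integral>\<^sup>+\<omega>. H (X \<omega>, Y \<omega>) \<partial>\<Omega>)"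
      unfolding H_def
    proof (intro nn_integral_cong SUP_cong refl)
      fix \<omega> q assume "q \<in> D"
      moreover obtain K L where q: "q = (K, L)" by (cases q)
      ultimately have KL_sub: "K \<subseteq> ?I" "L \<subseteq> ?I" using KL by (auto simp: D_def)
      show "(case q of (K, L) \<Rightarrow> lower_env ?I M P f K (X \<omega>) * lower_env ?I M P g L (Y \<omega>))
          = (case q of (K, L) \<Rightarrow> e f K (fst (X \<omega>, Y \<omega>)) * e g L (snd (X \<omega>, Y \<omega>)))"
        by (simp only: q prod.case fst_conv snd_conv lower[OF KL_sub(1)] lower[OF KL_sub(2)])
    qed
    also have "\<dots> = (\<integral>\<^sup>+p. H p \<partial>(PiM ?I N \<Otimes>\<^sub>M PiM ?I N))" by (rule int_XY[OF H])
    also have "\<dots> \<le> (\<integral>\<^sup>+x. ennreal (f x) * ennreal (g x) \<partial>PiM ?I N)"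
      unfolding H_def D_def e_def
      by (rule dual_reimer_lower_env[OF N finite_atLeastAtMost f_meas g_meas KL])
    also have "\<dots> = (\<integral>\<^sup>+\<omega>. ennreal (f (X \<omega>)) * ennreal (g (X \<omega>)) \<partial>\<Omega>)"
      by (rule int_X[symmetric]) (intro borel_measurable_times_ennreal f_meas g_meas)
    also have "\<dots> = (\<integral>\<^sup>+\<omega>. ennreal (f (X \<omega>) * g (X \<omega>)) \<partial>\<Omega>)"
      by (intro nn_integral_cong) (use f0 sp in \<open>auto simp: ennreal_mult' space_N\<close>)
    finally show "(\<integral>\<^sup>+\<omega>. (SUP (K, L)\<in>{(K, L). K \<in> \<K> \<and> L \<in> \<L> \<and> K \<inter> L = {}}.
                 lower_env ?I M P f K (X \<omega>) * lower_env ?I M P g L (Y \<omega>)) \<partial>\<Omega>)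
        \<le> (\<integral>\<^sup>+\<omega>. ennreal (f (X \<omega>) * g (X \<omega>)) \<partial>\<Omega>)"
      unfolding D_def .
  }
qed
end
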